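(* Let $p \equiv 2 \pmod 3$ be a prime and let $w$ be a positive integer whose squarefree part is divisible by $p$. Then there is no $\mathrm{CGW}(n,w;6)$ when $n$ is an odd positive integer.
   Context: For a positive integer $k$, let $\zeta_k = e^{2\pi\sqrt{-1}/k}$ and $\mathcal{U}_k = \{0\} \cup \{\zeta_k^j : 0 \le j \le k-1\}$. A $\mathrm{CGW}(n,w;k)$ (complex generalized weighing matrix of order $n$ and weight $w$) is an $n \times n$ matrix $W$ with entries in $\mathcal{U}_k$ such that $WW^{*} = wI_n$, where $W^*$ is the complex conjugate transpose. The squarefree part of $w$ is the unique squarefree positive integer $s$ with $w = s a^2$ for some integer $a$; thus $p$ divides it if and only if the exact power of $p$ dividing $w$ has odd exponent. *)

theory Defs
  imports
    "HOL-Computational_Algebra.Squarefree"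
    "HOL-Number_Theory.Cong"
    "Jordan_Normal_Form.Schur_Decomposition"
    Complex_Main
begin

definition root_unity :: "nat \<Rightarrow> complex" where
  "root_unity k = exp (2 * complex_of_real pi * \<i> / of_nat k)"

definition cgw_entries :: "nat \<Rightarrow> complex set" where
  "cgw_entries k = {0} \<union> {root_unity k ^ j | j. j \<le> k - 1}"

definition is_CGW :: "nat \<Rightarrow> nat \<Rightarrow> nat \<Rightarrow> complex mat \<Rightarrow> bool" where
  "is_CGW n w k W \<longleftrightarrow>
     W \<in> carrier_mat n n \<and>
     (\<forall>i<n. \<forall>j<n. W $$ (i, j) \<in> cgw_entries k) \<and>
     W * mat_adjoint W = of_nat w \<cdot>\<^sub>m 1\<^sub>m n"

text \<open>The library defines \<open>mat_adjoint\<close> through lists of columns; on square complex matrices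
  it is the conjugate transpose.\<close>

lemma index_mat_adjoint:
  fixes W :: "complex mat"
  assumes "W \<in> carrier_mat n n" "i < n" "j < n"
  shows "mat_adjoint W $$ (i, j) = cnj (W $$ (j, i))"
  using assms by (simp add: mat_adjoint_def mat_of_rows_def)

text \<open>The library's \<open>squarefree_part\<close> is characterised, for positive arguments, as the unique
  squarefree \<open>s\<close> with \<open>w = s * a\<^sup>2\<close>; existence is
  \<open>squarefree_decompose\<close> together with \<open>squarefree_squarefree_part\<close>.\<close>

lemma squarefree_part_unique:
  fixes w s a :: nat
  assumes "w > 0" "squarefree s" "w = s * a ^ 2"
  shows "squarefree_part w = s"
proof (rule multiplicity_eq_nat)
  have nz: "s \<noteq> 0" "a \<noteq> 0" using assms by auto
  show "squarefree_part w > 0" using squarefree_part_nonzero[of w] by (rule neq0_conv[THEN iffD1])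
  show "s > 0" using nz by simp
  fix q :: nat assume q: "prime q"
  have "multiplicity q w = multiplicity q s + 2 * multiplicity q a"
    using q nz assms(3)
    by (simp add: prime_elem_multiplicity_mult_distrib prime_elem_multiplicity_power_distrib)
  moreover have "multiplicity q s \<le> 1"
    using assms(2) q nz by (simp add: squarefree_factorial_semiring'')
  ultimately show "multiplicity q (squarefree_part w) = multiplicity q s"
    using q by (simp add: prime_multiplicity_squarefree_part)
qed

end

theory Submission
  imports Defs "HOL-Number_Theory.Residues"
begin

text \<open>Entries of a \<open>CGW(n,w;6)\<close> are Eisenstein integers, so its determinant is
  an Eisenstein integer of norm \<open>w\<^sup>n\<close>. A prime \<open>p \<equiv> 2 (mod 3)\<close> is inert, hence occurs
  in every norm \<open>a\<^sup>2 + ab + b\<^sup>2\<close> with even exponent, whereas its exponent in \<open>w\<^sup>n\<close> is odd.\<close>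

text \<open>If p divided neither number, a/b would be a cube root of 1 in the field with p elements.
  Since 3 does not divide p - 1, this forces a = b mod p, and the form becomes 3*b^2, which is
  nonzero mod p.\<close>

lemma prime_dvd_eisenstein_norm:
  fixes a b :: int and p :: nat
  assumes p: "prime p" and p3: "[p = 2] (mod 3)"
    and dvd: "int p dvd a^2 + a*b + b^2"
  shows "int p dvd a \<and> int p dvd b"
proof (rule ccontr)
  assume neg: "\<not> ?thesis"
  have pp: "prime (int p)" using p by simp
  have iff: "int p dvd a \<longleftrightarrow> int p dvd b"
  proof
    assume "int p dvd a"
    then have "int p dvd a^2 + a*b" by (simp add: power2_eq_square)
    with dvd have "int p dvd b^2" by (metis dvd_add_right_iff)
    then show "int p dvd b" using pp prime_dvd_power by blast
  next
    assume "int p dvd b"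
    then have "int p dvd a*b + b^2" by (simp add: power2_eq_square)
    moreover have "int p dvd a^2 + (a*b + b^2)" using dvd by (simp add: add.assoc)
    ultimately have "int p dvd a^2" by (metis dvd_add_left_iff)
    then show "int p dvd a" using pp prime_dvd_power by blast
  qed
  with neg have na: "\<not> int p dvd a" and nb: "\<not> int p dvd b" by auto
  from p3 have "p mod 3 = 2" by (simp add: cong_def)
  then obtain k where k: "p = 3*k + 2" by (metis mult.commute mod_div_mult_eq add.commute)
  \<comment> \<open>\<open>a\<^sup>3 - b\<^sup>3 = (a - b)(a\<^sup>2 + ab + b\<^sup>2)\<close>, and cubing is injective on units since
    \<open>p - 1\<close> is coprime to 3.\<close>
  have "a^3 - b^3 = (a - b) * (a^2 + a*b + b^2)"
    by (simp add: algebra_simps power2_eq_square power3_eq_cube)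
  with dvd have "[a^3 = b^3] (mod int p)" by (simp add: cong_iff_dvd_diff)
  then have "[(a^3)^k = (b^3)^k] (mod int p)" by (rule cong_pow)
  then have ck: "[a^(3*k) = b^(3*k)] (mod int p)" by (simp add: power_mult)
  \<comment> \<open>Since p - 1 = 3*k + 1, Fermat makes x^(3*k) an inverse of x. It depends only on
    x^3, so equal cubes have equal inverses.\<close>
  have fermat: "[x^(3*k) * x = 1] (mod int p)" if "\<not> int p dvd x" for x :: int
  proof -
    have "coprime x (int p)"
      using prime_imp_coprime[OF pp that] by (simp add: coprime_commute)
    moreover have "residues (int p)"
      using prime_gt_1_nat[OF p] by (simp add: residues_def)
    ultimately have "[x^(p - 1) = 1] (mod int p)"
      using residues.euler_theorem totient_prime[OF p] by fastforce
    moreover have "p - 1 = Suc (3*k)" using k by simp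
    ultimately show ?thesis by (simp add: mult.commute)
  qed
  have "[b^(3*k) * a = a^(3*k) * a] (mod int p)"
    using ck by (intro cong_mult cong_refl) (rule cong_sym)
  also have "[a^(3*k) * a = 1] (mod int p)" by (rule fermat[OF na])
  also have "[1 = b^(3*k) * b] (mod int p)" by (rule cong_sym[OF fermat[OF nb]])
  finally have "[b^(3*k) * a = b^(3*k) * b] (mod int p)" .
  then have "int p dvd b^(3*k) * (a - b)" by (simp add: cong_iff_dvd_diff right_diff_distrib)
  moreover have "\<not> int p dvd b^(3*k)" using nb pp prime_dvd_power by blast
  ultimately have ab: "int p dvd a - b" using pp prime_dvd_mult_iff by blast
  \<comment> \<open>Expanding around a = b leaves the remainder 3*b^2, so p would divide 3,
    impossible for p = 3*k + 2.\<close>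
  have "a^2 + a*b + b^2 = (a - b) * (a + 2*b) + 3 * b^2"
    by (simp add: algebra_simps power2_eq_square)
  with dvd ab have "int p dvd 3 * b^2" by (metis dvd_add_right_iff dvd_mult2)
  then have "int p dvd 3 \<or> int p dvd b"
    using pp prime_dvd_mult_iff prime_dvd_power by blast
  with nb have "int p dvd int 3" by simp
  then have "p dvd 3" by (simp only: int_dvd_int_iff)
  moreover from this have "p \<le> 3" by (rule dvd_imp_le) simp
  with k have "p = 2" by simp
  ultimately show False by simp
qed

text \<open>Norms are integers while \<open>w\<close> and its squarefree part are naturals; this
  carries exponents across.\<close>

lemma multiplicity_int_int:
  assumes "prime p" "m > 0"
  shows "multiplicity (int p) (int m) = multiplicity p m"
proof (rule multiplicity_eqI)
  show "int p ^ multiplicity p m dvd int m"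
    by (simp only: of_nat_power[symmetric] int_dvd_int_iff multiplicity_dvd)
  have "\<not> p ^ Suc (multiplicity p m) dvd m"
    using assms by (subst power_dvd_iff_le_multiplicity) auto
  then show "\<not> int p ^ Suc (multiplicity p m) dvd int m"
    by (simp only: of_nat_power[symmetric] int_dvd_int_iff not_False_eq_True)
qed

text \<open>Dividing a and b by their gcd g takes a factor g^2 out of the norm. The cofactors are
  coprime, so p does not divide what remains.\<close>

lemma even_multiplicity_eisenstein_norm:
  fixes a b :: int and p :: nat
  assumes p: "prime p" and p3: "[p = 2] (mod 3)"
    and nz: "a^2 + a*b + b^2 \<noteq> 0"
  shows "even (multiplicity (int p) (a^2 + a*b + b^2))"
proof -
  have pp: "prime_elem (int p)" using p by simp
  define g where "g = gcd a b"
  have g: "g \<noteq> 0" using nz by (auto simp: g_def)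
  then obtain a' b' where a: "a = a' * g" and b: "b = b' * g" and co: "coprime a' b'"
    unfolding g_def using gcd_coprime_exists by blast
  define M where "M = a'^2 + a'*b' + b'^2"
  have eq: "a^2 + a*b + b^2 = g^2 * M"
    by (simp add: a b M_def algebra_simps power2_eq_square)
  have "\<not> int p dvd M"
  proof
    assume "int p dvd M"
    then have "int p dvd a'" "int p dvd b'"
      using prime_dvd_eisenstein_norm[OF p p3] unfolding M_def by blast+
    with co have "is_unit (int p)" using coprime_common_divisor by blast
    with pp show False by (simp add: prime_elem_def)
  qed
  then have "multiplicity (int p) M = 0" by (rule not_dvd_imp_multiplicity_0)
  with nz show ?thesis unfolding eq using pp g
    by (simp add: prime_elem_multiplicity_mult_distrib prime_elem_multiplicity_power_distrib)
qed

text \<open>With \<omega> a primitive cube root of unity in the upper half plane,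
  \<open>root_unity 6\<close> is 1 + \<omega>, so this is the ring Z[\<omega>]. In this basis the
  norm form has cross term +ab.\<close>

definition eisenstein :: "complex set" where
  "eisenstein = {of_int a + of_int b * root_unity 6 | a b. True}"

lemma root_unity_6: "root_unity 6 = Complex (1/2) (sqrt 3 / 2)"
proof -
  have "root_unity 6 = cis (pi / 3)"
    by (simp add: root_unity_def cis_conv_exp field_simps)
  then show ?thesis by (simp add: cis.code cos_60 sin_60)
qed

text \<open>The sixth cyclotomic polynomial x^2 - x + 1, used to rewrite products in the
  basis.\<close>

lemma root_unity_6_squared: "root_unity 6 * root_unity 6 = root_unity 6 - 1"
  by (simp add: root_unity_6 complex_eq_iff)

lemma eisenstein_of_int: "of_int a \<in> eisenstein"
  unfolding eisenstein_def by (rule CollectI, rule exI[of _ a], rule exI[of _ 0]) simp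

lemma eisenstein_root_unity: "root_unity 6 \<in> eisenstein"
  unfolding eisenstein_def by (rule CollectI, rule exI[of _ 0], rule exI[of _ 1]) simp

lemma eisenstein_add:
  assumes "x \<in> eisenstein" "y \<in> eisenstein"
  shows "x + y \<in> eisenstein"
proof -
  from assms obtain a b c d where "x = of_int a + of_int b * root_unity 6"
    "y = of_int c + of_int d * root_unity 6" unfolding eisenstein_def by blast
  then have "x + y = of_int (a + c) + of_int (b + d) * root_unity 6"
    by (simp add: algebra_simps)
  then show ?thesis unfolding eisenstein_def by blast
qed

lemma eisenstein_mult:
  assumes "x \<in> eisenstein" "y \<in> eisenstein"
  shows "x * y \<in> eisenstein"
proof -
  from assms obtain a b c d where xy: "x = of_int a + of_int b * root_unity 6"
    "y = of_int c + of_int d * root_unity 6" unfolding eisenstein_def by blast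
  have "x * y = of_int a * of_int c + (of_int a * of_int d + of_int b * of_int c) * root_unity 6
      + of_int b * of_int d * (root_unity 6 * root_unity 6)"
    unfolding xy by (simp add: algebra_simps)
  also have "\<dots> = of_int (a*c - b*d) + of_int (a*d + b*c + b*d) * root_unity 6"
    unfolding root_unity_6_squared by (simp add: algebra_simps)
  finally show ?thesis unfolding eisenstein_def by blast
qed

lemma eisenstein_power: "x \<in> eisenstein \<Longrightarrow> x ^ k \<in> eisenstein"
  using eisenstein_of_int[of 1] by (induction k) (auto intro: eisenstein_mult)

lemma eisenstein_sum: "(\<And>i. i \<in> A \<Longrightarrow> f i \<in> eisenstein) \<Longrightarrow> sum f A \<in> eisenstein"
  \<comment> \<open>0 is the value of the empty sum and, by convention, of a sum over an infinite
    set.\<close>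
  using eisenstein_of_int[of 0]
  by (induction A rule: infinite_finite_induct) (auto intro: eisenstein_add)

lemma eisenstein_prod: "(\<And>i. i \<in> A \<Longrightarrow> f i \<in> eisenstein) \<Longrightarrow> prod f A \<in> eisenstein"
  using eisenstein_of_int[of 1]
  by (induction A rule: infinite_finite_induct) (auto intro: eisenstein_mult)

lemma cgw_entries_6_subset_eisenstein: "cgw_entries 6 \<subseteq> eisenstein"
  using eisenstein_of_int[of 0]
  by (auto simp: cgw_entries_def intro: eisenstein_power eisenstein_root_unity)

text \<open>The cross term is ab times twice the real part of \<open>root_unity 6\<close>, which is
  1.\<close>

lemma eisenstein_mult_cnj:
  assumes "x \<in> eisenstein"
  obtains a b :: int where "x * cnj x = of_int (a^2 + a*b + b^2)"
proof -
  from assms obtain a b where x: "x = of_int a + of_int b * root_unity 6"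
    unfolding eisenstein_def by blast
  have "x * cnj x = of_int (a^2 + a*b + b^2)"
    unfolding x root_unity_6
    by (simp add: complex_eq_iff power2_eq_square field_simps)
  then show ?thesis by (rule that)
qed

text \<open>The Leibniz expansion uses only sums, products and signs, under which the ring is
  closed.\<close>

lemma det_in_eisenstein:
  assumes "A \<in> carrier_mat n n" "\<And>i j. i < n \<Longrightarrow> j < n \<Longrightarrow> A $$ (i, j) \<in> eisenstein"
  shows "det A \<in> eisenstein"
proof -
  have sign: "(signof q :: complex) \<in> eisenstein" for q
    using eisenstein_of_int[of 1] eisenstein_of_int[of "-1"] by (simp add: sign_def)
  have "signof q * (\<Prod>i = 0..<n. A $$ (i, q i)) \<in> eisenstein" if "q permutes {0..<n}" for q
  proof (intro eisenstein_mult sign eisenstein_prod)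
    fix i assume "i \<in> {0..<n}"
    with permutes_in_image[OF that, of i] show "A $$ (i, q i) \<in> eisenstein"
      by (intro assms(2)) auto
  qed
  then show ?thesis unfolding det_def'[OF assms(1)] by (intro eisenstein_sum) simp
qed

lemma mat_adjoint_carrier:
  assumes "A \<in> carrier_mat n m"
  shows "mat_adjoint A \<in> carrier_mat m n"
  using assms unfolding mat_adjoint_def
  by (intro carrier_matI) (simp_all add: mat_of_rows_def)

text \<open>Conjugation is a ring homomorphism, so it commutes with the determinant, and
  transposition preserves the determinant.\<close>

lemma det_mat_adjoint:
  fixes A :: "complex mat"
  assumes A: "A \<in> carrier_mat n n"
  shows "det (mat_adjoint A) = cnj (det A)"
proof -
  interpret comm_ring_hom cnj by unfold_locales simp_all
  have "mat_adjoint A = transpose_mat (map_mat cnj A)"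
  proof (rule eq_matI)
    fix i j assume "i < dim_row (transpose_mat (map_mat cnj A))"
      "j < dim_col (transpose_mat (map_mat cnj A))"
    then show "mat_adjoint A $$ (i, j) = transpose_mat (map_mat cnj A) $$ (i, j)"
      using A by (simp add: index_mat_adjoint[OF A])
  qed (use A mat_adjoint_carrier[OF A] in simp_all)
  then have "det (mat_adjoint A) = det (map_mat cnj A)"
    using A by (simp only: det_transpose[of _ n] map_carrier_mat)
  then show ?thesis by (simp only: hom_det)
qed

theorem proposition2p9:
  fixes p w n :: nat
  assumes "prime p"
    and "[p = 2] (mod 3)"
    and "w > 0"
    and "p dvd squarefree_part w"
    and "n > 0"
    and "odd n"
  shows "\<not> (\<exists>W :: complex mat. is_CGW n w 6 W)"
proof
  assume "\<exists>W :: complex mat. is_CGW n w 6 W"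
  then obtain W :: "complex mat" where W: "W \<in> carrier_mat n n"
    and ent: "\<And>i j. i < n \<Longrightarrow> j < n \<Longrightarrow> W $$ (i, j) \<in> cgw_entries 6"
    and eq: "W * mat_adjoint W = of_nat w \<cdot>\<^sub>m 1\<^sub>m n"
    unfolding is_CGW_def by blast
  have adj: "mat_adjoint W \<in> carrier_mat n n" using W by (rule mat_adjoint_carrier)
  have "det W * cnj (det W) = of_nat w ^ n"
    using arg_cong[OF eq, of det] W adj by (simp add: det_mult det_mat_adjoint)
  moreover have "det W \<in> eisenstein"
    using W ent cgw_entries_6_subset_eisenstein by (intro det_in_eisenstein) auto
  then obtain a b :: int where "det W * cnj (det W) = of_int (a^2 + a*b + b^2)"
    by (rule eisenstein_mult_cnj)
  ultimately have "(of_int (a^2 + a*b + b^2) :: complex) = of_int (int (w ^ n))" by simp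
  then have N: "a^2 + a*b + b^2 = int (w ^ n)" by (simp only: of_int_eq_iff)
  then have "even (multiplicity (int p) (int (w ^ n)))"
    using even_multiplicity_eisenstein_norm[OF assms(1,2), of a b] \<open>w > 0\<close> by simp
  then have "even (n * multiplicity p w)"
    using assms(1,3)
    by (simp add: multiplicity_int_int prime_elem_multiplicity_power_distrib del: of_nat_power)
  \<comment> \<open>The exponent of p in the squarefree part is the exponent in w reduced mod 2;
    being nonzero, it is 1.\<close>
  moreover have "odd (multiplicity p w)"
  proof -
    have "multiplicity p (squarefree_part w) \<noteq> 0"
      using assms(1,4) by (subst multiplicity_eq_zero_iff) auto
    then show ?thesis
      using assms(1) by (simp add: prime_multiplicity_squarefree_part odd_iff_mod_2_eq_one)
  qed
  ultimately show False using \<open>odd n\<close> by simp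
qed

end
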